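(* Let $H:\mathbb R\to\mathbb R$ be smooth, convex and coercive, i.e. $\lim_{|p|\to\infty}H(p)=+\infty$, and let $u_0:\mathbb T\to\mathbb R$ be smooth. Let $F:\mathbb R\times\mathbb R\to\mathbb R$ satisfy: (i) $F$ is convex; (ii) $F(\cdot,q)$ is increasing for each $q\in\mathbb R$ and $F(p,\cdot)$ is increasing for each $p\in\mathbb R$; (iii) $F(-p,p)=H(p)$ for every $p\in\mathbb R$. For every $h>0$ let $u^h:\mathbb T\times[0,\infty)\to\mathbb R$ be the solution of $$u^h_t+F(-\delta_h u^h,\delta_{-h}u^h)=0\ \text{ in }\mathbb T\times(0,\infty),\qquad u^h=u_0\ \text{ on }\mathbb T\times\{t=0\},$$ and let $u$ be the unique viscosity solution of $$u_t+H(u_x)=0\ \text{ in }\mathbb T\times(0,\infty),\qquad u=u_0\ \text{ on }\mathbb T\times\{t=0\}.$$ Then for every $T\in(0,\infty)$ there exists a positive constant $C=C(T)$, independent of $h$, such that for every $h>0$ $$\sup_{t\in[0,T]}\|u(\cdot,t)-u^h(\cdot,t)\|_{L^\infty(\mathbb T)}\le C\sqrt h .$$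
   Context: $\mathbb T$ is the one-dimensional torus $\mathbb R/\mathbb Z$, identified with $[0,1]$ when convenient; functions on $\mathbb T$ are regarded as $1$-periodic functions on $\mathbb R$. For $h\in\mathbb R\setminus\{0\}$ and $v:\mathbb T\to\mathbb R$, $\delta_h v(x):=\frac{v(x+h)-v(x)}{h}$, so that $\delta_{-h}v(x)=\frac{v(x)-v(x-h)}{h}$ for $h>0$; difference quotients always act on the space variable $x$. "Increasing" is meant in the non-strict sense (nondecreasing). A solution $u^h$ of the semi-discrete problem is a continuous function on $\mathbb T\times[0,\infty)$ with $u^h(x,\cdot)\in C^1([0,\infty))$ for every $x\in\mathbb T$ that satisfies the equation pointwise. The constant $C$ may depend on $H$, $F$, $u_0$ and $T$, but not on $h$. *)

theory Defs
  imports
    "HOL-Analysis.Analysis"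
    "HOL-Probability.Essential_Supremum"
    "HOL-Library.Periodic_Fun"
begin

(* Functions on the torus R/Z are 1-periodic functions on R. Functions on T x [0,infinity) are
   curried, space variable first; their values at negative times are never constrained or used. *)

definition smooth :: "(real \<Rightarrow> real) \<Rightarrow> bool" where
  "smooth f \<longleftrightarrow> (\<forall>n x. ((deriv ^^ n) f) field_differentiable (at x))"

definition torus_Linf_norm :: "(real \<Rightarrow> real) \<Rightarrow> ereal" where
  "torus_Linf_norm v = esssup (lebesgue_on {0..1}) (\<lambda>x. ereal \<bar>v x\<bar>)"

definition diff_quot :: "real \<Rightarrow> (real \<Rightarrow> real) \<Rightarrow> real \<Rightarrow> real" where
  "diff_quot h v x = (v (x + h) - v x) / h"

definition continuous_on_torus_time :: "(real \<Rightarrow> real \<Rightarrow> real) \<Rightarrow> bool" where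
  "continuous_on_torus_time u \<longleftrightarrow>
     (\<forall>t\<ge>0. periodic_fun_simple' (\<lambda>x. u x t)) \<and>
     continuous_on (UNIV \<times> {0..}) (\<lambda>(x, t). u x t)"

(* C^1 up to the boundary point 0, where the derivative is one-sided. *)
definition C1_halfline :: "(real \<Rightarrow> real) \<Rightarrow> bool" where
  "C1_halfline g \<longleftrightarrow>
     (\<exists>g'. continuous_on {0..} g' \<and>
           (\<forall>t\<ge>0. (g has_real_derivative g' t) (at t within {0..})))"

definition semidiscrete_solution ::
  "(real \<Rightarrow> real \<Rightarrow> real) \<Rightarrow> (real \<Rightarrow> real) \<Rightarrow> real \<Rightarrow> (real \<Rightarrow> real \<Rightarrow> real) \<Rightarrow> bool" where
  "semidiscrete_solution F u0 h v \<longleftrightarrow>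
     continuous_on_torus_time v \<and>
     (\<forall>x. C1_halfline (v x)) \<and>
     (\<forall>x. \<forall>t>0. deriv (v x) t
        + F (- diff_quot h (\<lambda>y. v y t) x) (diff_quot (- h) (\<lambda>y. v y t) x) = 0) \<and>
     (\<forall>x. v x 0 = u0 x)"

(* phi is C^1 on R x (0,infinity), with partial derivatives phix and phit. *)
definition C1_test ::
  "(real \<Rightarrow> real \<Rightarrow> real) \<Rightarrow> (real \<Rightarrow> real \<Rightarrow> real) \<Rightarrow> (real \<Rightarrow> real \<Rightarrow> real) \<Rightarrow> bool" where
  "C1_test \<phi> \<phi>x \<phi>t \<longleftrightarrow>
     continuous_on (UNIV \<times> {0<..}) (\<lambda>(x, t). \<phi>x x t) \<and>
     continuous_on (UNIV \<times> {0<..}) (\<lambda>(x, t). \<phi>t x t) \<and>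
     (\<forall>x. \<forall>t>0. ((\<lambda>y. \<phi> y t) has_real_derivative \<phi>x x t) (at x) \<and>
                (\<phi> x has_real_derivative \<phi>t x t) (at t))"

definition local_max_at :: "(real \<Rightarrow> real \<Rightarrow> real) \<Rightarrow> real \<Rightarrow> real \<Rightarrow> bool" where
  "local_max_at w x0 t0 \<longleftrightarrow> (\<forall>\<^sub>F (x, t) in nhds (x0, t0). w x t \<le> w x0 t0)"

(* Test functions need not be periodic: the touching condition is local, so testing on R x (0,infinity)
   is the same as testing on T x (0,infinity). *)
definition viscosity_subsolution :: "(real \<Rightarrow> real) \<Rightarrow> (real \<Rightarrow> real \<Rightarrow> real) \<Rightarrow> bool" where
  "viscosity_subsolution H u \<longleftrightarrow>
     (\<forall>\<phi> \<phi>x \<phi>t x0 t0. C1_test \<phi> \<phi>x \<phi>t \<longrightarrow> t0 > 0 \<longrightarrow>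
        local_max_at (\<lambda>x t. u x t - \<phi> x t) x0 t0 \<longrightarrow>
        \<phi>t x0 t0 + H (\<phi>x x0 t0) \<le> 0)"

definition viscosity_supersolution :: "(real \<Rightarrow> real) \<Rightarrow> (real \<Rightarrow> real \<Rightarrow> real) \<Rightarrow> bool" where
  "viscosity_supersolution H u \<longleftrightarrow>
     (\<forall>\<phi> \<phi>x \<phi>t x0 t0. C1_test \<phi> \<phi>x \<phi>t \<longrightarrow> t0 > 0 \<longrightarrow>
        local_max_at (\<lambda>x t. \<phi> x t - u x t) x0 t0 \<longrightarrow>
        \<phi>t x0 t0 + H (\<phi>x x0 t0) \<ge> 0)"

definition viscosity_solution ::
  "(real \<Rightarrow> real) \<Rightarrow> (real \<Rightarrow> real) \<Rightarrow> (real \<Rightarrow> real \<Rightarrow> real) \<Rightarrow> bool" where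
  "viscosity_solution H u0 u \<longleftrightarrow>
     continuous_on_torus_time u \<and>
     viscosity_subsolution H u \<and> viscosity_supersolution H u \<and>
     (\<forall>x. u x 0 = u0 x)"

end

theory Submission
  imports Defs
begin

text \<open>
  Let \<open>v = uh h\<close>. Comparing \<open>v\<close> with its translates shows that \<open>v\<close> inherits the Lipschitz constant
  \<open>L\<close> of \<open>u0\<close> in space. Now maximise \<open>u(x,t) - v(y,t) - (x-y)\<^sup>2/(2\<epsilon>) - \<lambda>t\<close>. Doubling the time
  variable is unnecessary since \<open>v(y,\<cdot>)\<close> is \<open>C\<^sup>1\<close> and so can be part of the test function. At a
  maximum with \<open>t > 0\<close> the slope \<open>p = (x-y)/\<epsilon>\<close> satisfies \<open>|p| \<le> 2L\<close>, and maximality in \<open>y\<close> together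
  with monotonicity gives \<open>v\<^sub>t \<ge> - F(-p+r, p+r)\<close> with \<open>r = h/(2\<epsilon>)\<close>. By convexity
  \<open>F(-p+r, p+r) \<le> H(p) + O(r)\<close>, whence \<open>\<lambda> = O(r)\<close>. Since the initial error is at most \<open>L\<^sup>2\<epsilon>/2\<close>, the
  choice \<open>\<epsilon> = \<surd>h\<close> is optimal; \<open>\<epsilon> = max (\<surd>h) h\<close> keeps \<open>r\<close> bounded for large \<open>h\<close>, where the initial
  error is controlled by the oscillation of \<open>u0\<close>. The reverse inequality follows on replacing
  \<open>u, v, H(p), F(p,q)\<close> by \<open>-u, -v, -H(-p), -F(-p,-q)\<close>.
\<close>

section \<open>Periodicity, continuity and time regularity\<close>

lemma periodic_shift_to_unit:
  assumes "periodic_fun_simple' (f :: real \<Rightarrow> 'a)"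
  shows "f (x - of_int \<lfloor>x\<rfloor>) = f x"
proof -
  interpret periodic_fun_simple' f by fact
  show ?thesis by (rule minus_of_int)
qed

lemma unit_frac: "x - of_int \<lfloor>x\<rfloor> \<in> {0..1::real}"
  by (simp add: le_floor_iff) linarith

lemma torus_periodic:
  assumes "continuous_on_torus_time u" "t \<ge> 0"
  shows "periodic_fun_simple' (\<lambda>x. u x t)"
  using assms unfolding continuous_on_torus_time_def by blast

lemma torus_shift:
  assumes "continuous_on_torus_time u" "t \<ge> 0"
  shows "u (x + of_int k) t = u x t"
proof -
  interpret periodic_fun_simple' "\<lambda>x. u x t" using assms by (rule torus_periodic)
  show ?thesis by (rule plus_of_int)
qed

lemma torus_continuous_on:
  assumes "continuous_on_torus_time u" "continuous_on S f" "continuous_on S g"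
    and "\<And>z. z \<in> S \<Longrightarrow> g z \<ge> 0"
  shows "continuous_on S (\<lambda>z. u (f z) (g z))"
proof -
  have "continuous_on (UNIV \<times> {0..}) (\<lambda>(x, t). u x t)"
    using assms(1) unfolding continuous_on_torus_time_def by blast
  then have "continuous_on S (\<lambda>z. (\<lambda>(x, t). u x t) (f z, g z))"
    by (rule continuous_on_compose2) (use assms in \<open>auto intro!: continuous_intros\<close>)
  then show ?thesis by simp
qed

lemma semidiscrete_DERIV:
  assumes "semidiscrete_solution F v0 h v" "t > 0"
  shows "(v x has_real_derivative deriv (v x) t) (at t)"
proof -
  obtain g' where "\<forall>t\<ge>0. (v x has_real_derivative g' t) (at t within {0..})"
    using assms unfolding semidiscrete_solution_def C1_halfline_def by blast
  with assms(2) have "(v x has_real_derivative g' t) (at t within {0..})" by simp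
  moreover have "at t within {0..} = at t"
    using assms(2) by (intro at_within_interior) simp
  ultimately show ?thesis
    by (metis DERIV_imp_deriv)
qed

text \<open>Needed because \<open>v y0\<close> becomes part of a test function, and
  \<open>C1_test\<close> asks for a continuous time derivative.\<close>

lemma semidiscrete_deriv_continuous:
  assumes "semidiscrete_solution F v0 h v"
  shows "continuous_on {0<..} (deriv (v x))"
proof -
  obtain g' where c: "continuous_on {0..} g'"
    and g: "\<forall>t\<ge>0. (v x has_real_derivative g' t) (at t within {0..})"
    using assms unfolding semidiscrete_solution_def C1_halfline_def by blast
  have "deriv (v x) t = g' t" if "t > 0" for t
  proof -
    have "at t within {0..} = at t"
      using that by (intro at_within_interior) simp
    with g that show ?thesis by (metis DERIV_imp_deriv less_imp_le)
  qed
  moreover have "continuous_on {0<..} g'"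
    using c by (rule continuous_on_subset) auto
  ultimately show ?thesis
    by (metis (no_types, lifting) continuous_on_cong greaterThan_iff)
qed

text \<open>In this form both arguments of \<open>F\<close> are decrements from \<open>x\<close> to
  a neighbour divided by the positive step. A maximum bounds such decrements from above, and
  \<open>F\<close> is monotone in them.\<close>

lemma semidiscrete_equation:
  assumes "semidiscrete_solution F v0 h v" "t > 0"
  shows "deriv (v x) t = - F ((v x t - v (x + h) t) / h) ((v x t - v (x - h) t) / h)"
proof -
  have eq: "deriv (v x) t + F (- diff_quot h (\<lambda>y. v y t) x) (diff_quot (- h) (\<lambda>y. v y t) x) = 0"
    using assms unfolding semidiscrete_solution_def by blast
  have "- diff_quot h (\<lambda>y. v y t) x = (v x t - v (x + h) t) / h"
    "diff_quot (- h) (\<lambda>y. v y t) x = (v x t - v (x - h) t) / h"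
    unfolding diff_quot_def by (simp_all add: minus_divide_left minus_divide_right[symmetric] diff_divide_distrib)
  with eq show ?thesis by simp
qed

section \<open>Comparison principle and spatial Lipschitz bound for the scheme\<close>

lemma mono_both_args:
  assumes "\<And>q. mono (\<lambda>p. F p q)" "\<And>p. mono (\<lambda>q. F p q)" "a \<le> c" "b \<le> d"
  shows "F a b \<le> F c d"
  using monoD[OF assms(1) assms(3), of b] monoD[OF assms(2) assms(4), of c] by (rule order_trans)

text \<open>At a maximum of \<open>v - w - l * s\<close> with positive time, the decrements of
  \<open>v\<close> dominate those of \<open>w\<close>, so monotonicity of \<open>F\<close> makes
  \<open>v\<close> grow no faster than \<open>w\<close>. Maximality in time forces it to grow faster
  by at least \<open>l > 0\<close>.\<close>

lemma semidiscrete_comparison: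
  assumes v: "semidiscrete_solution F v0 h v" and w: "semidiscrete_solution F w0 h w"
    and h: "h > 0"
    and m1: "\<And>q. mono (\<lambda>p. F p q)" and m2: "\<And>p. mono (\<lambda>q. F p q)"
    and init: "\<And>x. v0 x - w0 x \<le> c" and t: "t \<ge> 0"
  shows "v x t - w x t \<le> c"
proof (rule ccontr)
  assume "\<not> ?thesis"
  then have gt: "v x t - w x t - c > 0" by simp
  have cv: "continuous_on_torus_time v" and cw: "continuous_on_torus_time w"
    and v0: "\<And>x. v x 0 = v0 x" and w0: "\<And>x. w x 0 = w0 x"
    using v w unfolding semidiscrete_solution_def by auto
  have "t \<noteq> 0" using gt init[of x] v0 w0 by auto
  with t have tp: "t > 0" by simp
  \<comment> \<open>Half of the excess is spent on the penalty \<open>l * s\<close> by time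
    \<open>t\<close>, so the penalised maximum still exceeds \<open>c\<close>.\<close>
  define l where "l = (v x t - w x t - c) / (2 * t)"
  have l: "l > 0" "l * t < v x t - w x t - c" using gt tp by (auto simp: l_def)
  define g where "g = (\<lambda>(y, s). v y s - w y s - l * s)"
  have D: "compact ({0..1::real} \<times> {0..t})" "{0..1::real} \<times> {0..t} \<noteq> {}"
    using t by (auto intro!: compact_Times)
  have "continuous_on ({0..1::real} \<times> {0..t}) g"
    unfolding g_def case_prod_unfold
    by (intro continuous_intros torus_continuous_on[OF cv] torus_continuous_on[OF cw]) auto
  from continuous_attains_sup[OF D this] obtain z0 where z0: "z0 \<in> {0..1::real} \<times> {0..t}"
    and max0: "\<And>z. z \<in> {0..1::real} \<times> {0..t} \<Longrightarrow> g z \<le> g z0"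
    by blast
  obtain x0 t0 where z0_eq: "z0 = (x0, t0)" by fastforce
  have t0: "0 \<le> t0" "t0 \<le> t" using z0 z0_eq by auto
  have max: "v y s - w y s - l * s \<le> v x0 t0 - w x0 t0 - l * t0" if "0 \<le> s" "s \<le> t" for y s
  proof -
    have "g (y - of_int \<lfloor>y\<rfloor>, s) \<le> g z0"
      by (rule max0) (use that unit_frac[of y] in auto)
    then show ?thesis
      using periodic_shift_to_unit[OF torus_periodic[OF cv that(1)], of y]
        periodic_shift_to_unit[OF torus_periodic[OF cw that(1)], of y]
      by (simp add: g_def z0_eq)
  qed
  have big: "v x0 t0 - w x0 t0 - l * t0 > c"
    using max[of t x] t l by linarith
  have "t0 \<noteq> 0" using big init[of x0] v0 w0 by auto
  with t0 have t0p: "t0 > 0" by simp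
  have D: "((\<lambda>s. v x0 s - w x0 s - l * s) has_real_derivative
      deriv (v x0) t0 - deriv (w x0) t0 - l) (at t0)"
    by (auto intro!: derivative_eq_intros semidiscrete_DERIV[OF v t0p] semidiscrete_DERIV[OF w t0p])
  \<comment> \<open>The maximum may sit at the final time \<open>t\<close>, so only earlier times
    can be compared.\<close>
  have "\<not> deriv (v x0) t0 - deriv (w x0) t0 - l < 0"
  proof
    assume "deriv (v x0) t0 - deriv (w x0) t0 - l < 0"
    from DERIV_neg_dec_left[OF D this] obtain d where d: "d > 0"
      "\<And>k. k > 0 \<Longrightarrow> k < d \<Longrightarrow>
        v x0 t0 - w x0 t0 - l * t0 < v x0 (t0 - k) - w x0 (t0 - k) - l * (t0 - k)"
      by blast
    define k where "k = min (d / 2) t0"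
    have "k > 0" "k < d" "k \<le> t0" using d t0p by (auto simp: k_def)
    with d(2)[of k] max[of "t0 - k" x0] t0 show False by auto
  qed
  then have "deriv (w x0) t0 < deriv (v x0) t0" using l by linarith
  moreover have "F ((w x0 t0 - w (x0 + h) t0) / h) ((w x0 t0 - w (x0 - h) t0) / h)
      \<le> F ((v x0 t0 - v (x0 + h) t0) / h) ((v x0 t0 - v (x0 - h) t0) / h)"
  proof -
    have "(w x0 t0 - w (x0 + h) t0) / h \<le> (v x0 t0 - v (x0 + h) t0) / h"
      "(w x0 t0 - w (x0 - h) t0) / h \<le> (v x0 t0 - v (x0 - h) t0) / h"
      using max[OF t0, of "x0 + h"] max[OF t0, of "x0 - h"] h
      by (auto intro!: divide_right_mono)
    then show ?thesis by (rule mono_both_args[OF m1 m2])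
  qed
  ultimately show False
    using semidiscrete_equation[OF v t0p, of x0] semidiscrete_equation[OF w t0p, of x0] by linarith
qed

lemma semidiscrete_translate:
  assumes "semidiscrete_solution F v0 h v"
  shows "semidiscrete_solution F (\<lambda>x. v0 (x + k)) h (\<lambda>x. v (x + k))"
proof -
  have c: "continuous_on_torus_time v" using assms unfolding semidiscrete_solution_def by blast
  have "continuous_on_torus_time (\<lambda>x. v (x + k))"
    unfolding continuous_on_torus_time_def
  proof (intro conjI allI impI)
    fix t :: real assume "t \<ge> 0"
    then show "periodic_fun_simple' (\<lambda>x. v (x + k) t)"
      using torus_shift[OF c, of t "_ + k" 1] by unfold_locales (simp add: add_ac)
  next
    show "continuous_on (UNIV \<times> {0..}) (\<lambda>(x, t). v (x + k) t)"
      unfolding case_prod_unfold by (intro continuous_intros torus_continuous_on[OF c]) auto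
  qed
  moreover have "diff_quot h' (\<lambda>y. v (y + k) t) x = diff_quot h' (\<lambda>y. v y t) (x + k)" for h' t x
    unfolding diff_quot_def by (simp add: add_ac)
  ultimately show ?thesis
    using assms unfolding semidiscrete_solution_def by simp
qed

text \<open>The translate of \<open>v\<close> by \<open>x - y\<close> solves the same scheme, and
  its initial data differ from \<open>v0\<close> by at most
  \<open>L * \<bar>x - y\<bar>\<close>.\<close>

lemma semidiscrete_lipschitz:
  assumes v: "semidiscrete_solution F v0 h v" and h: "h > 0"
    and m1: "\<And>q. mono (\<lambda>p. F p q)" and m2: "\<And>p. mono (\<lambda>q. F p q)"
    and lip: "\<And>x y. v0 x - v0 y \<le> L * \<bar>x - y\<bar>" and t: "t \<ge> 0"
  shows "v x t - v y t \<le> L * \<bar>x - y\<bar>"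
proof -
  have "v (y + (x - y)) t - v y t \<le> L * \<bar>x - y\<bar>"
    by (rule semidiscrete_comparison[OF semidiscrete_translate[OF v] v h m1 m2 _ t])
      (use lip in \<open>metis add_diff_cancel_left'\<close>)
  then show ?thesis by simp
qed

section \<open>Doubling of the space variable\<close>

text \<open>The structure of \<open>F\<close> beyond monotonicity enters only through the one-sided
  bound \<open>FH\<close>. The lemma therefore also serves the reflected
  \<open>- F (- p) (- q)\<close>, which is concave when \<open>F\<close> is convex.\<close>

lemma doubled_difference_bound:
  fixes h \<epsilon> L :: real
  defines "r \<equiv> h / (2 * \<epsilon>)"
  assumes u: "continuous_on_torus_time u" "viscosity_subsolution H u"
    and v: "semidiscrete_solution F v0 h v"
    and h: "h > 0" and \<epsilon>: "\<epsilon> > 0"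
    and m1: "\<And>q. mono (\<lambda>p. F p q)" and m2: "\<And>p. mono (\<lambda>q. F p q)"
    and L: "L \<ge> 0" and lip: "\<And>x y. v0 x - v0 y \<le> L * \<bar>x - y\<bar>"
    and K: "K \<ge> 0" and FH: "\<And>p. \<bar>p\<bar> \<le> 2 * L \<Longrightarrow> F (- p + r) (p + r) \<le> H p + K"
    and init: "\<And>x y. u x 0 - v0 y - (x - y)\<^sup>2 / (2 * \<epsilon>) \<le> I"
    and t: "t \<ge> 0"
  shows "u x t - v x t \<le> I + K * t"
proof (rule ccontr)
  assume not_le: "\<not> ?thesis"
  define e where "e = u x t - v x t - I - K * t"
  have e: "e > 0" using not_le by (simp add: e_def)
  have cv: "continuous_on_torus_time v" and v0: "\<And>x. v x 0 = v0 x"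
    using v unfolding semidiscrete_solution_def by auto
  have "t \<noteq> 0" using init[of x x] e v0 by (auto simp: e_def)
  with t have tp: "t > 0" by simp
  \<comment> \<open>Beyond this distance the quadratic penalty outweighs the Lipschitz bound on
    \<open>v\<close>. The same radius yields \<open>\<bar>p\<bar> \<le> 2 * L\<close> at the
    maximum.\<close>
  define R where "R = 2 * L * \<epsilon>"
  have R: "R \<ge> 0" using L \<epsilon> by (simp add: R_def)
  \<comment> \<open>The middle coordinate is the offset \<open>y - x\<close>, which keeps the search
    region compact. The horizon \<open>2 * t\<close> leaves room beyond \<open>t\<close> for a
    maximum interior in time.\<close>
  define S where "S = {0..1::real} \<times> {-R..R} \<times> {0..2 * t}"
  have S: "compact S" "S \<noteq> {}"
    using tp R unfolding S_def by (auto intro!: compact_Times)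
  have cont: "continuous_on S (\<lambda>(x, z, s). u x s - v (x + z) s)"
    unfolding case_prod_unfold
    by (intro continuous_intros torus_continuous_on[OF cv] torus_continuous_on[OF u(1)])
      (auto simp: S_def)
  obtain B where B: "\<And>x z s. (x, z, s) \<in> S \<Longrightarrow> u x s - v (x + z) s \<le> B"
    using continuous_attains_sup[OF S cont] by fast
  \<comment> \<open>Of the excess \<open>e\<close>, one quarter goes to \<open>\<eta>\<close> and
    another to the slope \<open>l\<close>, so the penalised value at \<open>(x, x, t)\<close> is
    still \<open>I + e / 2\<close>.\<close>
  define \<eta> where "\<eta> = e / 4"
  have \<eta>: "\<eta> > 0" using e by (simp add: \<eta>_def)
  obtain n where "(B - I) / \<eta> < 2 ^ n"
    using real_arch_pow[of 2 "(B - I) / \<eta>"] by auto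
  then have n: "B - \<eta> * 2 ^ n < I"
    using \<eta> by (simp add: field_simps)
  define l where "l = K + e / (4 * t)"
  have l: "l > K" "l * t = K * t + e / 4" using e tp by (auto simp: l_def field_simps)
  \<comment> \<open>This penalty is at most \<open>\<eta>\<close> at time \<open>t\<close> but excludes a maximum at the final time \<open>2t\<close>.\<close>
  define pen where "pen = (\<lambda>s. l * s + \<eta> * (s / t) ^ n)"
  define G where "G = (\<lambda>x y s. u x s - v y s - (x - y)\<^sup>2 / (2 * \<epsilon>) - pen s)"
  have "continuous_on S (\<lambda>(x, z, s). G x (x + z) s)"
    unfolding case_prod_unfold G_def pen_def
    by (intro continuous_intros torus_continuous_on[OF cv] torus_continuous_on[OF u(1)])
      (use tp \<epsilon> in \<open>auto simp: S_def\<close>)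
  from continuous_attains_sup[OF S this] obtain x0 z0 t0 where
    in_S: "(x0, z0, t0) \<in> S" and
    max0: "\<And>x z s. (x, z, s) \<in> S \<Longrightarrow> G x (x + z) s \<le> G x0 (x0 + z0) t0"
    by fast
  define y0 where "y0 = x0 + z0"
  have t0: "0 \<le> t0" "t0 \<le> 2 * t" using in_S by (auto simp: S_def)
  have far: "G x y s \<le> G x x s" if "\<bar>x - y\<bar> > R" "s \<ge> 0" for x y s
  proof -
    have "v x s - v y s \<le> L * \<bar>x - y\<bar>"
      by (rule semidiscrete_lipschitz[OF v h m1 m2 lip that(2)])
    also have "\<dots> \<le> \<bar>x - y\<bar> * \<bar>x - y\<bar> / (2 * \<epsilon>)"
    proof -
      have "L \<le> \<bar>x - y\<bar> / (2 * \<epsilon>)" using that(1) \<epsilon> by (simp add: R_def field_simps)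
      from mult_right_mono[OF this, of "\<bar>x - y\<bar>"] show ?thesis by simp
    qed
    also have "\<dots> = (x - y)\<^sup>2 / (2 * \<epsilon>)" by (simp add: power2_eq_square)
    finally show ?thesis by (simp add: G_def)
  qed
  \<comment> \<open>Shifting \<open>x\<close> and \<open>y\<close> by the same integer leaves
    \<open>G\<close> unchanged and brings \<open>x\<close> into \<open>{0..1}\<close>.\<close>
  have near: "G x y s \<le> G x0 y0 t0" if "\<bar>x - y\<bar> \<le> R" "0 \<le> s" "s \<le> 2 * t" for x y s
  proof -
    define k where "k = - \<lfloor>x\<rfloor>"
    have x1: "x + of_int k \<in> {0..1}" using unit_frac[of x] by (simp add: k_def)
    have "G (x + of_int k) (x + of_int k + (y - x)) s \<le> G x0 (x0 + z0) t0"
      by (rule max0) (use that x1 in \<open>auto simp: S_def\<close>)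
    moreover have "x + of_int k + (y - x) = y + of_int k" by simp
    ultimately have "G (x + of_int k) (y + of_int k) s \<le> G x0 (x0 + z0) t0" by simp
    then show ?thesis
      by (simp add: G_def y0_def torus_shift[OF u(1) that(2)] torus_shift[OF cv that(2)])
  qed
  have max: "G x y s \<le> G x0 y0 t0" if "0 \<le> s" "s \<le> 2 * t" for x y s
  proof (cases "\<bar>x - y\<bar> \<le> R")
    case True
    then show ?thesis using that by (rule near)
  next
    case False
    then have "G x y s \<le> G x x s" using that by (intro far) auto
    also have "\<dots> \<le> G x0 y0 t0" using that R by (intro near) auto
    finally show ?thesis .
  qed
  have big: "G x0 y0 t0 > I"
  proof -
    have "G x x t = u x t - v x t - l * t - \<eta>"
      using tp by (simp add: G_def pen_def)
    moreover have "u x t - v x t = e + I + K * t" by (simp add: e_def)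
    ultimately have "G x x t > I" using e l(2) unfolding \<eta>_def by linarith
    with max[of t x x] tp show ?thesis by simp
  qed
  have pen_pos: "pen s \<ge> 0" if "s \<ge> 0" for s
    using that K l \<eta> tp by (simp add: pen_def)
  have "t0 \<noteq> 0"
    using big init[of x0 y0] v0 pen_pos[of 0] by (auto simp: G_def)
  with t0 have t0p: "t0 > 0" by simp
  have "t0 \<noteq> 2 * t"
  proof
    assume *: "t0 = 2 * t"
    have "pen t0 = l * t0 + \<eta> * 2 ^ n" using * tp by (simp add: pen_def)
    moreover have "l * t0 \<ge> 0" using l K t0 by simp
    moreover have "(x0 - y0)\<^sup>2 / (2 * \<epsilon>) \<ge> 0" using \<epsilon> by simp
    ultimately have "G x0 y0 t0 \<le> B - \<eta> * 2 ^ n"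
      using B[OF in_S] by (simp add: G_def y0_def)
    with n big show False by linarith
  qed
  with t0 have t0l: "t0 < 2 * t" by simp
  define p where "p = (x0 - y0) / \<epsilon>"
  have p: "\<bar>p\<bar> \<le> 2 * L"
    using in_S \<epsilon> by (auto simp: p_def y0_def S_def R_def field_simps)
  \<comment> \<open>For \<open>n = 0\<close> the truncated exponent \<open>n - 1\<close> is
    harmless, since the factor \<open>real n\<close> vanishes.\<close>
  define pen' where "pen' = (\<lambda>s. l + \<eta> * (real n * (s / t) ^ (n - 1) / t))"
  have pen': "(pen has_real_derivative pen' s) (at s)" for s
    unfolding pen_def pen'_def
    by (rule derivative_eq_intros refl | use tp in \<open>simp add: field_simps\<close>)+
  have "C1_test (\<lambda>x s. v y0 s + (x - y0)\<^sup>2 / (2 * \<epsilon>) + pen s)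
      (\<lambda>x s. (x - y0) / \<epsilon>) (\<lambda>x s. deriv (v y0) s + pen' s)"
    unfolding C1_test_def
  proof (intro conjI allI impI)
    show "continuous_on (UNIV \<times> {0<..}) (\<lambda>(x::real, s::real). (x - y0) / \<epsilon>)"
      unfolding case_prod_unfold by (intro continuous_intros) (use \<epsilon> in auto)
    have "continuous_on (UNIV \<times> {0<..}) (\<lambda>z::real \<times> real. deriv (v y0) (snd z))"
      by (rule continuous_on_compose2[OF semidiscrete_deriv_continuous[OF v]])
        (auto intro!: continuous_intros)
    then show "continuous_on (UNIV \<times> {0<..}) (\<lambda>(x::real, s::real). deriv (v y0) s + pen' s)"
      unfolding case_prod_unfold pen'_def by (intro continuous_intros) (use tp in auto)
  next
    fix x s :: real
    show "((\<lambda>y. v y0 s + (y - y0)\<^sup>2 / (2 * \<epsilon>) + pen s) has_real_derivative (x - y0) / \<epsilon>) (at x)"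
      using \<epsilon> by (auto intro!: derivative_eq_intros simp: field_simps)
  next
    fix x s :: real assume "s > 0"
    show "((\<lambda>s. v y0 s + (x - y0)\<^sup>2 / (2 * \<epsilon>) + pen s) has_real_derivative
        deriv (v y0) s + pen' s) (at s)"
      by (auto intro!: derivative_eq_intros semidiscrete_DERIV[OF v \<open>s > 0\<close>] pen')
  qed
  moreover have "local_max_at (\<lambda>x s. u x s - (v y0 s + (x - y0)\<^sup>2 / (2 * \<epsilon>) + pen s)) x0 t0"
    unfolding local_max_at_def
  proof -
    have "open (UNIV \<times> {0<..<2 * t} :: (real \<times> real) set)" by (intro open_Times) auto
    then have "\<forall>\<^sub>F z in nhds (x0, t0). z \<in> UNIV \<times> {0<..<2 * t}"
      by (rule eventually_nhds_in_open) (use t0p t0l in auto)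
    then show "\<forall>\<^sub>F (x, s) in nhds (x0, t0). u x s - (v y0 s + (x - y0)\<^sup>2 / (2 * \<epsilon>) + pen s)
        \<le> u x0 t0 - (v y0 t0 + (x0 - y0)\<^sup>2 / (2 * \<epsilon>) + pen t0)"
    proof (eventually_elim, clarify)
      fix x s :: real assume "s \<in> {0<..<2 * t}"
      then show "u x s - (v y0 s + (x - y0)\<^sup>2 / (2 * \<epsilon>) + pen s)
        \<le> u x0 t0 - (v y0 t0 + (x0 - y0)\<^sup>2 / (2 * \<epsilon>) + pen t0)"
        using max[of s x y0] by (simp add: G_def algebra_simps)
    qed
  qed
  ultimately have visc: "deriv (v y0) t0 + pen' t0 + H p \<le> 0"
    using u(2) t0p unfolding viscosity_subsolution_def p_def by blast
  \<comment> \<open>Maximality is tested against \<open>y0 + h\<close> and \<open>y0 - h\<close>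
    with \<open>x0\<close> fixed. Expanding the squares gives the linear terms \<open>- p\<close>
    and \<open>p\<close>, and the quadratic remainder is \<open>r\<close> in both cases.\<close>
  have "F ((v y0 t0 - v (y0 + h) t0) / h) ((v y0 t0 - v (y0 - h) t0) / h) \<le> F (- p + r) (p + r)"
  proof -
    have "v y0 t0 - v (y0 + h) t0 \<le> (x0 - (y0 + h))\<^sup>2 / (2 * \<epsilon>) - (x0 - y0)\<^sup>2 / (2 * \<epsilon>)"
      using max[OF t0, of x0 "y0 + h"] by (simp add: G_def)
    also have "\<dots> = (- p + r) * h"
      using \<epsilon> by (simp add: p_def r_def field_simps power2_eq_square)
    finally have 1: "(v y0 t0 - v (y0 + h) t0) / h \<le> - p + r"
      using h by (simp add: pos_divide_le_eq)
    have "v y0 t0 - v (y0 - h) t0 \<le> (x0 - (y0 - h))\<^sup>2 / (2 * \<epsilon>) - (x0 - y0)\<^sup>2 / (2 * \<epsilon>)"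
      using max[OF t0, of x0 "y0 - h"] by (simp add: G_def)
    also have "\<dots> = (p + r) * h"
      using \<epsilon> by (simp add: p_def r_def field_simps power2_eq_square)
    finally have 2: "(v y0 t0 - v (y0 - h) t0) / h \<le> p + r"
      using h by (simp add: pos_divide_le_eq)
    from 1 2 show ?thesis by (rule mono_both_args[OF m1 m2])
  qed
  with FH[OF p] semidiscrete_equation[OF v t0p, of y0]
  have "- H p - K \<le> deriv (v y0) t0" by linarith
  moreover have "pen' t0 \<ge> l" using \<eta> tp t0 by (simp add: pen'_def)
  ultimately show False using visc l by linarith
qed

section \<open>Reflection symmetry\<close>

text \<open>If \<open>\<phi>\<close> touches \<open>- u\<close> from above, then
  \<open>- \<phi>\<close> touches \<open>u\<close> from below, with both partial derivatives
  negated.\<close>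

lemma viscosity_subsolution_uminus:
  assumes "viscosity_supersolution H u"
  shows "viscosity_subsolution (\<lambda>p. - H (- p)) (\<lambda>x t. - u x t)"
  unfolding viscosity_subsolution_def
proof (intro allI impI)
  fix \<phi> \<phi>x \<phi>t :: "real \<Rightarrow> real \<Rightarrow> real" and x0 t0 :: real
  assume C1: "C1_test \<phi> \<phi>x \<phi>t" and t0: "t0 > 0"
    and max: "local_max_at (\<lambda>x t. - u x t - \<phi> x t) x0 t0"
  have "C1_test (\<lambda>x t. - \<phi> x t) (\<lambda>x t. - \<phi>x x t) (\<lambda>x t. - \<phi>t x t)"
    using C1 unfolding C1_test_def case_prod_unfold
    by (auto intro!: continuous_on_minus DERIV_minus)
  moreover have "local_max_at (\<lambda>x t. - \<phi> x t - u x t) x0 t0"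
    using max unfolding local_max_at_def by (simp add: algebra_simps)
  ultimately have "- \<phi>t x0 t0 + H (- \<phi>x x0 t0) \<ge> 0"
    using assms t0 unfolding viscosity_supersolution_def by blast
  then show "\<phi>t x0 t0 + - H (- \<phi>x x0 t0) \<le> 0" by simp
qed

lemma torus_uminus:
  assumes "continuous_on_torus_time u"
  shows "continuous_on_torus_time (\<lambda>x t. - u x t)"
  unfolding continuous_on_torus_time_def
proof (intro conjI allI impI)
  fix t :: real assume "t \<ge> 0"
  then show "periodic_fun_simple' (\<lambda>x. - u x t)"
    using torus_shift[OF assms, of t _ 1] by unfold_locales simp
next
  show "continuous_on (UNIV \<times> {0..}) (\<lambda>(x, t). - u x t)"
    unfolding case_prod_unfold by (intro continuous_intros torus_continuous_on[OF assms]) auto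
qed

text \<open>Difference quotients are linear, so the sign passes through them and is absorbed by
  reflecting \<open>F\<close> in both arguments.\<close>

lemma semidiscrete_uminus:
  assumes v: "semidiscrete_solution F v0 h v"
  shows "semidiscrete_solution (\<lambda>p q. - F (- p) (- q)) (\<lambda>x. - v0 x) h (\<lambda>x t. - v x t)"
  unfolding semidiscrete_solution_def
proof (intro conjI allI impI)
  show "continuous_on_torus_time (\<lambda>x t. - v x t)"
    using v torus_uminus unfolding semidiscrete_solution_def by blast
next
  fix x
  obtain g' where "continuous_on {0..} g'"
    "\<forall>t\<ge>0. (v x has_real_derivative g' t) (at t within {0..})"
    using v unfolding semidiscrete_solution_def C1_halfline_def by blast
  then show "C1_halfline (\<lambda>t. - v x t)"
    unfolding C1_halfline_def
    by (intro exI[of _ "\<lambda>t. - g' t"]) (auto intro!: continuous_on_minus DERIV_minus)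
next
  fix x t :: real assume t: "t > 0"
  have "deriv (\<lambda>t. - v x t) t = - deriv (v x) t"
    by (intro DERIV_imp_deriv DERIV_minus semidiscrete_DERIV[OF v t])
  moreover have "diff_quot k (\<lambda>y. - v y t) x = - diff_quot k (\<lambda>y. v y t) x" for k
    unfolding diff_quot_def by (simp add: minus_divide_left)
  moreover have "deriv (v x) t
      + F (- diff_quot h (\<lambda>y. v y t) x) (diff_quot (- h) (\<lambda>y. v y t) x) = 0"
    using v t unfolding semidiscrete_solution_def by blast
  ultimately show "deriv (\<lambda>t. - v x t) t + - F (- (- diff_quot h (\<lambda>y. - v y t) x))
      (- diff_quot (- h) (\<lambda>y. - v y t) x) = 0"
    by simp
next
  show "- v x 0 = - v0 x" for x using v unfolding semidiscrete_solution_def by simp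
qed

section \<open>Lipschitz initial data and the sup norm\<close>

text \<open>The continuous derivative is bounded on one period, and periodicity carries this bound
  to the whole line.\<close>

lemma periodic_smooth_lipschitz:
  assumes per: "periodic_fun_simple' f" and sm: "smooth f"
  obtains L where "L \<ge> 0" "\<And>x y. \<bar>f x - f y\<bar> \<le> L * \<bar>x - y\<bar>"
proof -
  have D: "(f has_real_derivative deriv f x) (at x)" for x
    using sm unfolding smooth_def
    by (metis DERIV_deriv_iff_field_differentiable funpow_0)
  have "deriv f field_differentiable (at x)" for x
    using sm[unfolded smooth_def, rule_format, of 1] by simp
  then have "continuous_on {0..1} (deriv f)"
    by (meson continuous_at_imp_continuous_on field_differentiable_imp_continuous_at)
  then have "bounded (deriv f ` {0..1})"
    by (intro compact_imp_bounded compact_continuous_image) auto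
  then obtain L where L: "\<And>x. x \<in> {0..1} \<Longrightarrow> \<bar>deriv f x\<bar> \<le> L"
    unfolding bounded_iff real_norm_def by blast
  have "\<bar>deriv f x\<bar> \<le> L" for x
  proof -
    let ?k = "of_int \<lfloor>x\<rfloor> :: real"
    interpret periodic_fun_simple' f by (rule per)
    have "((\<lambda>y. f (y + ?k)) has_real_derivative deriv f x) (at (x - ?k))"
      using D[of x] DERIV_shift[of f "deriv f x" "x - ?k" "?k"] by simp
    then have "(f has_real_derivative deriv f x) (at (x - ?k))"
      by (simp add: plus_of_int)
    then have "deriv f (x - ?k) = deriv f x" by (rule DERIV_imp_deriv)
    with L[OF unit_frac[of x]] show ?thesis by simp
  qed
  then have "\<bar>f x - f y\<bar> \<le> L * \<bar>x - y\<bar>" for x y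
    using field_differentiable_bound[of UNIV f "deriv f" L x y] D by (simp add: has_field_derivative_at_within)
  moreover have "L \<ge> 0" using L[of 0] by simp
  ultimately show ?thesis using that by blast
qed

lemma torus_Linf_norm_le:
  assumes u: "continuous_on_torus_time u" and v: "continuous_on_torus_time v" and t: "t \<ge> 0"
    and bound: "\<And>x. \<bar>u x t - v x t\<bar> \<le> c"
  shows "torus_Linf_norm (\<lambda>x. u x t - v x t) \<le> ereal c"
  unfolding torus_Linf_norm_def
proof (rule esssup_I)
  have "continuous_on {0..1} (\<lambda>x. \<bar>u x t - v x t\<bar>)"
    by (intro continuous_intros torus_continuous_on[OF u] torus_continuous_on[OF v]) (use t in auto)
  then have "(\<lambda>x. \<bar>u x t - v x t\<bar>) \<in> borel_measurable (lebesgue_on {0..1})"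
    by (rule continuous_imp_measurable_on_sets_lebesgue) auto
  then show "(\<lambda>x. ereal \<bar>u x t - v x t\<bar>) \<in> borel_measurable (lebesgue_on {0..1})"
    by simp
  show "AE x in lebesgue_on {0..1}. ereal \<bar>u x t - v x t\<bar> \<le> ereal c"
    using bound by simp
qed

section \<open>Choice of constants and the rate\<close>

theorem theorem1p1:
  fixes H u0 :: "real \<Rightarrow> real"
    and F :: "real \<Rightarrow> real \<Rightarrow> real"
    and uh :: "real \<Rightarrow> real \<Rightarrow> real \<Rightarrow> real"
    and u :: "real \<Rightarrow> real \<Rightarrow> real"
  assumes H_smooth: "smooth H"
    and H_convex: "convex_on UNIV H"
    and H_coercive: "filterlim H at_top at_infinity"
    and u0_torus: "periodic_fun_simple' u0"
    and u0_smooth: "smooth u0"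
    and F_convex: "convex_on UNIV (\<lambda>(p, q). F p q)"
    and F_incr1: "\<And>q. mono (\<lambda>p. F p q)"
    and F_incr2: "\<And>p. mono (\<lambda>q. F p q)"
    and F_consistent: "\<And>p. F (- p) p = H p"
    and uh_solution: "\<And>h. h > 0 \<Longrightarrow> semidiscrete_solution F u0 h (uh h)"
    and u_solution: "viscosity_solution H u0 u"
  shows "\<forall>T>0. \<exists>C>0. \<forall>h>0.
           (SUP t\<in>{0..T}. torus_Linf_norm (\<lambda>x. u x t - uh h x t)) \<le> ereal (C * sqrt h)"
proof -
  have cu: "continuous_on_torus_time u" and sub: "viscosity_subsolution H u"
    and super: "viscosity_supersolution H u" and u_init: "\<And>x. u x 0 = u0 x"
    using u_solution unfolding viscosity_solution_def by auto
  obtain L where L: "L \<ge> 0" and lip: "\<And>x y. \<bar>u0 x - u0 y\<bar> \<le> L * \<bar>x - y\<bar>"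
    using periodic_smooth_lipschitz[OF u0_torus u0_smooth] by blast
  have osc: "\<bar>u0 x - u0 y\<bar> \<le> L" for x y
  proof -
    let ?x = "x - of_int \<lfloor>x\<rfloor>" and ?y = "y - of_int \<lfloor>y\<rfloor>"
    have "\<bar>u0 x - u0 y\<bar> = \<bar>u0 ?x - u0 ?y\<bar>"
      by (simp only: periodic_shift_to_unit[OF u0_torus])
    also have "\<dots> \<le> L * \<bar>?x - ?y\<bar>" by (rule lip)
    also have "\<dots> \<le> L * 1"
      using unit_frac[of x] unit_frac[of y] unfolding atLeastAtMost_iff
      by (intro mult_left_mono L) linarith
    finally show ?thesis by simp
  qed
  define P where "P = 2 * L"
  \<comment> \<open>By monotonicity this dominates \<open>F (- p + 1) (p + 1) - F (- p) p\<close>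
    for all slopes with \<open>\<bar>p\<bar> \<le> P\<close>.\<close>
  define K where "K = F (P + 1) (P + 1) - F (- P) (- P)"
  have F_mono: "F a b \<le> F c d" if "a \<le> c" "b \<le> d" for a b c d
    using mono_both_args[of F, OF F_incr1 F_incr2 that] .
  have K: "K \<ge> 0" unfolding K_def using F_mono[of "- P" "P + 1" "- P" "P + 1"] L by (simp add: P_def)
  \<comment> \<open>Convexity on the segment from \<open>(- p, p)\<close> to
    \<open>(- p + 1, p + 1)\<close>, at parameter \<open>r\<close>.\<close>
  have F_upper: "F (- p + r) (p + r) \<le> H p + K * r" if "\<bar>p\<bar> \<le> P" "0 \<le> r" "r \<le> 1" for p r
  proof -
    have "F (- p + r) (p + r) \<le> (1 - r) * F (- p) p + r * F (- p + 1) (p + 1)"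
      using convex_onD[OF F_convex that(2,3), of "(- p, p)" "(- p + 1, p + 1)"]
      by (simp add: algebra_simps)
    also have "\<dots> = H p + r * (F (- p + 1) (p + 1) - F (- p) p)"
      by (simp add: F_consistent algebra_simps)
    also have "\<dots> \<le> H p + r * K"
      unfolding K_def using that
      by (intro add_left_mono mult_left_mono diff_mono F_mono) auto
    finally show ?thesis by (simp add: mult.commute)
  qed
  \<comment> \<open>The point \<open>(- p, p)\<close> is the midpoint of the two diagonal shifts by
    \<open>r\<close>, so convexity turns the upper bound on one side into a lower bound on the
    other.\<close>
  have F_lower: "H p - K * r \<le> F (- p - r) (p - r)" if "\<bar>p\<bar> \<le> P" "0 \<le> r" "r \<le> 1" for p r
  proof -
    have "F (- p) p \<le> F (- p - r) (p - r) / 2 + F (- p + r) (p + r) / 2"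
    proof -
      have "(1/2) * (- p - r) + (1/2) * (- p + r) = - p" "(1/2) * (p - r) + (1/2) * (p + r) = p"
        by (simp_all add: field_simps)
      then show ?thesis
        using convex_onD[OF F_convex, of "1/2" "(- p - r, p - r)" "(- p + r, p + r)"] by simp
    qed
    then show ?thesis using F_upper[OF that] by (simp add: F_consistent)
  qed
  show ?thesis
  proof (intro allI impI)
    fix T :: real assume T: "T > 0"
    \<comment> \<open>The first summand covers \<open>h \<le> 1\<close>, the second
      \<open>h > 1\<close>. In \<open>C\<close>, the term \<open>K * T\<close> is the accumulated
      scheme error and \<open>1\<close> ensures positivity.\<close>
    define M where "M = L\<^sup>2 / 2 + L"
    define C where "C = M + K * T + 1"
    have "M \<ge> 0" using L by (simp add: M_def)
    have "C > 0" using L K T by (simp add: C_def M_def add_nonneg_pos)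
    moreover have "(SUP t\<in>{0..T}. torus_Linf_norm (\<lambda>x. u x t - uh h x t)) \<le> ereal (C * sqrt h)"
      if h: "h > 0" for h
    proof (rule SUP_least)
      fix t assume t: "t \<in> {0..T}"
      define \<epsilon> where "\<epsilon> = max (sqrt h) h"
      define r where "r = h / (2 * \<epsilon>)"
      have \<epsilon>: "\<epsilon> > 0" using h by (simp add: \<epsilon>_def)
      \<comment> \<open>\<open>h \<le> \<epsilon>\<close> gives \<open>r \<le> 1\<close>, as the
        convexity bounds require; \<open>sqrt h \<le> \<epsilon>\<close> gives
        \<open>r \<le> sqrt h\<close>, which produces the rate.\<close>
      have r: "0 \<le> r" "r \<le> 1" "r \<le> sqrt h"
      proof -
        show "0 \<le> r" using h \<epsilon> by (simp add: r_def)
        have "h \<le> \<epsilon>" by (simp add: \<epsilon>_def)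
        then show "r \<le> 1" using h \<epsilon> by (simp add: r_def)
        have "h = sqrt h * sqrt h" using h by simp
        also have "\<dots> \<le> sqrt h * (2 * \<epsilon>)"
          using h \<epsilon> by (intro mult_left_mono) (auto simp: \<epsilon>_def)
        finally show "r \<le> sqrt h" using \<epsilon> by (simp add: r_def pos_divide_le_eq)
      qed
      have init: "\<bar>u0 x - u0 y\<bar> - (x - y)\<^sup>2 / (2 * \<epsilon>) \<le> M * sqrt h" for x y
      proof (cases "h \<le> 1")
        case True
        have "\<epsilon> = sqrt h"
        proof -
          have "h * h \<le> h" using True h by (simp add: mult_left_le)
          then have "h \<le> sqrt h" by (intro real_le_rsqrt) (simp add: power2_eq_square)
          then show ?thesis by (simp add: \<epsilon>_def)
        qed
        \<comment> \<open>Completing the square: \<open>L * d - d\<^sup>2 / (2 * \<epsilon>)\<close>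
          is largest at \<open>d = L * \<epsilon>\<close>, with value
          \<open>L\<^sup>2 * \<epsilon> / 2\<close>.\<close>
        have "0 \<le> (\<bar>x - y\<bar> - L * \<epsilon>)\<^sup>2 / (2 * \<epsilon>)" using \<epsilon> by simp
        also have "\<dots> = (x - y)\<^sup>2 / (2 * \<epsilon>) - L * \<bar>x - y\<bar> + L\<^sup>2 / 2 * \<epsilon>"
        proof -
          have "(\<bar>x - y\<bar> - L * \<epsilon>)\<^sup>2 = (x - y)\<^sup>2 - 2 * L * \<epsilon> * \<bar>x - y\<bar> + L\<^sup>2 * \<epsilon>\<^sup>2"
            by (simp add: power2_diff power_mult_distrib)
          then show ?thesis using \<epsilon> by (simp add: field_simps power2_eq_square)
        qed
        finally have "\<bar>u0 x - u0 y\<bar> - (x - y)\<^sup>2 / (2 * \<epsilon>) \<le> L\<^sup>2 / 2 * \<epsilon>"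
          using lip[of x y] by linarith
        also have "\<dots> \<le> M * sqrt h"
          unfolding \<open>\<epsilon> = sqrt h\<close> M_def using L h by (intro mult_right_mono) auto
        finally show ?thesis .
      next
        case False
        have "\<bar>u0 x - u0 y\<bar> - (x - y)\<^sup>2 / (2 * \<epsilon>) \<le> \<bar>u0 x - u0 y\<bar>" using \<epsilon> by simp
        also have "\<dots> \<le> M" using osc[of x y] by (simp add: M_def add_increasing)
        also have "\<dots> \<le> M * sqrt h"
          using False \<open>M \<ge> 0\<close> by (simp add: mult_le_cancel_left1)
        finally show ?thesis .
      qed
      have v: "semidiscrete_solution F u0 h (uh h)" by (rule uh_solution[OF h])
      have "u x t - uh h x t \<le> M * sqrt h + (K * r) * t" for x
      proof (rule doubled_difference_bound[OF cu sub v h \<epsilon> F_incr1 F_incr2 L])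
        show "u0 x - u0 y \<le> L * \<bar>x - y\<bar>" for x y using lip[of x y] by linarith
        show "F (- p + h / (2 * \<epsilon>)) (p + h / (2 * \<epsilon>)) \<le> H p + K * r" if "\<bar>p\<bar> \<le> 2 * L" for p
          using F_upper[of p r] that r by (simp add: P_def r_def)
        show "u x 0 - u0 y - (x - y)\<^sup>2 / (2 * \<epsilon>) \<le> M * sqrt h" for x y
          using init[of x y] by (simp add: u_init)
      qed (use t K r in auto)
      moreover have "- u x t - - uh h x t \<le> M * sqrt h + (K * r) * t" for x
      proof (rule doubled_difference_bound[OF torus_uminus[OF cu]
            viscosity_subsolution_uminus[OF super] semidiscrete_uminus[OF v] h \<epsilon> _ _ L])
        show "mono (\<lambda>p. - F (- p) (- q))" "mono (\<lambda>p. - F (- q) (- p))" for q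
          by (auto intro!: monoI F_mono)
        show "- u0 x - - u0 y \<le> L * \<bar>x - y\<bar>" for x y using lip[of x y] by linarith
        \<comment> \<open>After reflection the required bound is \<open>F_lower\<close> at slope
          \<open>- p\<close>.\<close>
        show "- F (- (- p + h / (2 * \<epsilon>))) (- (p + h / (2 * \<epsilon>))) \<le> - H (- p) + K * r"
          if "\<bar>p\<bar> \<le> 2 * L" for p
          using F_lower[of "- p" r] that r by (simp add: P_def r_def)
        show "- u x 0 - - u0 y - (x - y)\<^sup>2 / (2 * \<epsilon>) \<le> M * sqrt h" for x y
          using init[of x y] by (simp add: u_init)
      qed (use t K r in auto)
      moreover have "M * sqrt h + (K * r) * t \<le> C * sqrt h"
      proof -
        have "(K * r) * t \<le> (K * sqrt h) * T"
          using t K r h by (intro mult_mono mult_nonneg_nonneg) auto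
        moreover have "C * sqrt h = M * sqrt h + (K * sqrt h) * T + sqrt h"
          by (simp add: C_def algebra_simps)
        moreover have "sqrt h \<ge> 0" using h by simp
        ultimately show ?thesis by linarith
      qed
      ultimately have "\<bar>u x t - uh h x t\<bar> \<le> C * sqrt h" for x
        by (smt (verit, best))
      moreover have "continuous_on_torus_time (uh h)"
        using v unfolding semidiscrete_solution_def by blast
      ultimately show "torus_Linf_norm (\<lambda>x. u x t - uh h x t) \<le> ereal (C * sqrt h)"
        using t by (intro torus_Linf_norm_le[OF cu]) auto
    qed
    ultimately show "\<exists>C>0. \<forall>h>0.
        (SUP t\<in>{0..T}. torus_Linf_norm (\<lambda>x. u x t - uh h x t)) \<le> ereal (C * sqrt h)"
      by blast
  qed
qed

end
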